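(* Let $X$ be a real or complex Banach space with scalar field $\mathbb{K}\in\{\mathbb{R},\mathbb{C}\}$, and let $T$ be a closable operator in $X$ whose domain $D(T)$ is separable (in the norm topology) and weakly $\sigma$-compact. Then the point spectrum $\sigma_p(T)$ is an $F_\sigma$ subset of $\mathbb{K}$.
   Context: Banach spaces are real or complex and need not be separable. An operator in $X$ is a linear map $T\colon D(T)\to X$ defined on a linear subspace $D(T)$ of $X$ (not necessarily bounded, closed or densely defined). $T$ is closable if the norm closure in $X\times X$ of its graph $\{(x,Tx): x\in D(T)\}$ is the graph of some operator in $X$. The point spectrum is $\sigma_p(T)=\{\lambda\in\mathbb{K} : \ker(T-\lambda)\neq\{0\}\}$, where $T-\lambda$ has domain $D(T)$. A subset of a Banach space is weakly $\sigma$-compact if it is a countable union of sets that are compact in the weak topology of the space. *)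

theory Defs
  imports "HOL-Analysis.Analysis"
begin

text \<open>
  Library types of class \<open>banach\<close> are real Banach spaces. To treat real and complex spaces at once,
  the scalar multiplication is an explicit parameter \<open>smul :: 'k \<Rightarrow> 'a \<Rightarrow> 'a\<close>, used
  with \<open>'k = real\<close> and \<open>'k = complex\<close>. A complex Banach space is a type of class \<open>banach\<close> with a
  complex scalar multiplication that extends the real one and is compatible with the norm.
\<close>

locale normed_space_over = vector_space smul
  for smul :: "'k::real_normed_field \<Rightarrow> 'a::real_normed_vector \<Rightarrow> 'a" +
  assumes scale_of_real: "smul (of_real r) x = r *\<^sub>R x"
    and norm_scale: "norm (smul c x) = norm c * norm x"

lemma normed_space_over_real_iff:
  "normed_space_over (smul :: real \<Rightarrow> 'a::real_normed_vector \<Rightarrow> 'a) \<longleftrightarrow> smul = scaleR"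
proof
  assume "normed_space_over smul"
  then show "smul = scaleR"
    using normed_space_over.scale_of_real[of smul] by fastforce
next
  assume "smul = scaleR"
  then show "normed_space_over smul"
    using real_vector.vector_space_axioms
    by (simp add: normed_space_over_def normed_space_over_axioms_def)
qed

lemma normed_space_over_complex_self: "normed_space_over ((*) :: complex \<Rightarrow> complex \<Rightarrow> complex)"
  by unfold_locales (simp_all add: algebra_simps scaleR_conv_of_real norm_mult)

definition dual_space ::
  "('k::real_normed_field \<Rightarrow> 'a::real_normed_vector \<Rightarrow> 'a) \<Rightarrow> ('a \<Rightarrow> 'k) set" where
  "dual_space smul = {f. Vector_Spaces.linear smul (*) f \<and> continuous_on UNIV f}"

definition weak_topology ::
  "('k::real_normed_field \<Rightarrow> 'a::real_normed_vector \<Rightarrow> 'a) \<Rightarrow> 'a topology" where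
  "weak_topology smul = topology_generated_by {f -` U | f U. f \<in> dual_space smul \<and> open U}"

lemma topspace_weak_topology:
  assumes "normed_space_over smul"
  shows "topspace (weak_topology smul) = UNIV"
proof -
  interpret normed_space_over smul by fact
  have "vector_space ((*) :: 'a \<Rightarrow> 'a \<Rightarrow> 'a)"
    by unfold_locales (simp_all add: algebra_simps)
  then have "Vector_Spaces.linear smul (*) (\<lambda>_. 0)"
    using vector_space_axioms
    by (simp add: Vector_Spaces.linear_def module_hom_def module_hom_axioms_def
        module_iff_vector_space)
  then have "(\<lambda>_. 0) -` UNIV \<in> {f -` U | f U. f \<in> dual_space smul \<and> open U}"
    unfolding dual_space_def by (blast intro: continuous_on_const)
  then show ?thesis
    unfolding weak_topology_def topology_generated_by_topspace by auto
qed

definition weakly_sigma_compact ::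
  "('k::real_normed_field \<Rightarrow> 'a::real_normed_vector \<Rightarrow> 'a) \<Rightarrow> 'a set \<Rightarrow> bool" where
  "weakly_sigma_compact smul S \<longleftrightarrow>
     (\<exists>\<K>. countable \<K> \<and> (\<forall>K\<in>\<K>. compactin (weak_topology smul) K) \<and> S = \<Union>\<K>)"

text \<open>
  An operator is a pair \<open>D\<close>, \<open>T\<close>: only the values of the total function \<open>T\<close> on the domain \<open>D\<close>
  are relevant in what follows.
\<close>

definition operator_in ::
  "('k::real_normed_field \<Rightarrow> 'a::real_normed_vector \<Rightarrow> 'a) \<Rightarrow> 'a set \<Rightarrow> ('a \<Rightarrow> 'a) \<Rightarrow> bool" where
  "operator_in smul D T \<longleftrightarrow>
     module.subspace smul D \<and>
     (\<forall>x\<in>D. \<forall>y\<in>D. T (x + y) = T x + T y) \<and>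
     (\<forall>c. \<forall>x\<in>D. T (smul c x) = smul c (T x))"

definition op_graph :: "'a set \<Rightarrow> ('a \<Rightarrow> 'a) \<Rightarrow> ('a \<times> 'a) set" where
  "op_graph D T = {(x, T x) | x. x \<in> D}"

definition closable_operator ::
  "('k::real_normed_field \<Rightarrow> 'a::real_normed_vector \<Rightarrow> 'a) \<Rightarrow> 'a set \<Rightarrow> ('a \<Rightarrow> 'a) \<Rightarrow> bool" where
  "closable_operator smul D T \<longleftrightarrow>
     operator_in smul D T \<and>
     (\<exists>E S. operator_in smul E S \<and> closure (op_graph D T) = op_graph E S)"

definition op_kernel :: "'a set \<Rightarrow> ('a \<Rightarrow> 'a::zero) \<Rightarrow> 'a set" where
  "op_kernel D T = {x \<in> D. T x = 0}"

definition point_spectrum ::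
  "('k \<Rightarrow> 'a::real_normed_vector \<Rightarrow> 'a) \<Rightarrow> 'a set \<Rightarrow> ('a \<Rightarrow> 'a) \<Rightarrow> 'k set" where
  "point_spectrum smul D T = {l. op_kernel D (\<lambda>x. T x - smul l x) \<noteq> {0}}"

end

theory Submission
  imports Defs
begin

text \<open>
  If \<open>T x = \<lambda> x\<close> with \<open>x \<in> D\<close>, then \<open>(x, \<lambda> x)\<close> lies in \<open>G\<close>, the closure of the graph of \<open>T\<close>, and
  conversely, since \<open>G\<close> is again a graph. By the Hahn-Banach theorem \<open>G\<close> is an intersection of
  kernels of functionals \<open>(u, v) \<mapsto> f u + g v\<close>, so \<open>{(x, \<lambda>). (x, \<lambda> x) \<in> G}\<close> is closed for the
  weak topology in \<open>x\<close>. Projecting along a weakly compact set \<open>K\<close> of vectors yields a closed set of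
  scalars. It remains to write \<open>D - {0}\<close> as a countable union of such \<open>K\<close>: separability and the
  Lindelof property give countably many functionals \<open>f\<close> without common zero in \<open>D - {0}\<close>, and one
  intersects the given weakly compact sets with the sets \<open>{x. \<bar>f x\<bar> \<ge> 1/n}\<close>.
\<close>

section \<open>Sublinear functionals and the Hahn-Banach theorem\<close>

definition sublinear :: "('a::real_vector \<Rightarrow> real) \<Rightarrow> bool" where
  "sublinear q \<longleftrightarrow> (\<forall>x y. q (x + y) \<le> q x + q y) \<and> (\<forall>t>0. \<forall>x. q (t *\<^sub>R x) = t * q x)"

lemma sublinear_add: "sublinear q \<Longrightarrow> q (x + y) \<le> q x + q y"
  by (simp add: sublinear_def)

lemma sublinear_zero:
  assumes "sublinear q"
  shows "q 0 = 0"
proof -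
  have "q (2 *\<^sub>R 0) = 2 * q 0"
    using assms unfolding sublinear_def by (metis zero_less_numeral)
  then show ?thesis by simp
qed

lemma sublinear_scale: "sublinear q \<Longrightarrow> t \<ge> 0 \<Longrightarrow> q (t *\<^sub>R x) = t * q x"
  using sublinear_zero[of q] by (cases "t = 0") (auto simp: sublinear_def)

lemma sublinear_minus: "sublinear q \<Longrightarrow> - q (- x) \<le> q x"
  using sublinear_add[of q x "- x"] sublinear_zero[of q] by simp

text \<open>The bound for \<open>inverse t\<close> at the point \<open>t *\<^sub>R x\<close> gives
  the reverse inequality, so homogeneity follows from one direction.\<close>

lemma sublinearI:
  assumes "\<And>x y. q (x + y) \<le> q x + q y"
    and le: "\<And>t x. t > 0 \<Longrightarrow> q (t *\<^sub>R x) \<le> t * q x"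
  shows "sublinear q"
  unfolding sublinear_def
proof (intro conjI allI impI antisym)
  fix t :: real and x assume t: "t > 0"
  have "q x = q (inverse t *\<^sub>R t *\<^sub>R x)" using t by simp
  also have "\<dots> \<le> inverse t * q (t *\<^sub>R x)" using t by (intro le) simp
  finally show "t * q x \<le> q (t *\<^sub>R x)" using t by (simp add: field_simps)
qed (use assms in auto)

lemma le_cINF_add:
  fixes f :: "'i \<Rightarrow> real" and g :: "'j \<Rightarrow> real"
  assumes "I \<noteq> {}" "J \<noteq> {}" and le: "\<And>i j. i \<in> I \<Longrightarrow> j \<in> J \<Longrightarrow> a \<le> f i + g j"
  shows "a \<le> (INF i\<in>I. f i) + (INF j\<in>J. g j)"
proof -
  have "a - (INF i\<in>I. f i) \<le> g j" if "j \<in> J" for j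
  proof -
    have "a - g j \<le> (INF i\<in>I. f i)"
      using assms(1) le[OF _ that] by (intro cINF_greatest) (auto simp: algebra_simps)
    then show ?thesis by simp
  qed
  then have "a - (INF i\<in>I. f i) \<le> (INF j\<in>J. g j)"
    using assms(2) by (intro cINF_greatest)
  then show ?thesis by simp
qed

text \<open>The index \<open>k\<close> may depend on the points as well as on \<open>i\<close> and
  \<open>j\<close>. This covers infima over shifts along a ray, over chains of functionals and over
  the points of a subspace.\<close>

lemma sublinear_INF:
  fixes q :: "'i \<Rightarrow> 'a::real_vector \<Rightarrow> real"
  assumes ne: "I \<noteq> {}" and bdd: "\<And>x. bdd_below ((\<lambda>i. q i x) ` I)"
    and add: "\<And>i j x y. i \<in> I \<Longrightarrow> j \<in> I \<Longrightarrow> \<exists>k\<in>I. q k (x + y) \<le> q i x + q j y"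
    and scale: "\<And>i t x. i \<in> I \<Longrightarrow> t > 0 \<Longrightarrow> \<exists>k\<in>I. q k (t *\<^sub>R x) \<le> t * q i x"
  shows "sublinear (\<lambda>x. INF i\<in>I. q i x)"
proof (rule sublinearI)
  fix x y
  show "(INF i\<in>I. q i (x + y)) \<le> (INF i\<in>I. q i x) + (INF i\<in>I. q i y)"
  proof (intro le_cINF_add ne)
    fix i j assume "i \<in> I" "j \<in> I"
    with add obtain k where "k \<in> I" "q k (x + y) \<le> q i x + q j y" by blast
    then show "(INF i\<in>I. q i (x + y)) \<le> q i x + q j y"
      using cINF_lower2[OF bdd] by blast
  qed
next
  fix t :: real and x assume t: "t > 0"
  have "(INF i\<in>I. q i (t *\<^sub>R x)) / t \<le> (INF i\<in>I. q i x)"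
  proof (intro cINF_greatest ne)
    fix i assume "i \<in> I"
    with scale t obtain k where "k \<in> I" "q k (t *\<^sub>R x) \<le> t * q i x" by blast
    then have "(INF i\<in>I. q i (t *\<^sub>R x)) \<le> t * q i x"
      using cINF_lower2[OF bdd] by blast
    then show "(INF i\<in>I. q i (t *\<^sub>R x)) / t \<le> q i x" using t by (simp add: field_simps)
  qed
  then show "(INF i\<in>I. q i (t *\<^sub>R x)) \<le> t * (INF i\<in>I. q i x)"
    using t by (simp add: field_simps)
qed

text \<open>
  Every sublinear \<open>q\<close> can be lowered to a sublinear functional that behaves linearly in a given
  direction \<open>y\<close>. Hence a minimal sublinear functional is linear.
\<close>

lemma sublinear_lower:
  assumes q: "sublinear q"
  obtains r where "sublinear r" "\<And>x. r x \<le> q x" "\<And>x. r x \<le> q (x + y) - q y"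
proof
  \<comment> \<open>The infimum is taken over \<open>t \<ge> 0\<close>: the index 0 gives
    \<open>r \<le> q\<close>, the index 1 the bound in direction \<open>y\<close>. Indices add under
    sums of vectors and scale under positive multiples.\<close>
  define s where "s t x = q (x + t *\<^sub>R y) - t * q y" for t x
  define r where "r x = (INF t\<in>{0..}. s t x)" for x
  have bdd: "bdd_below ((\<lambda>t. s t x) ` {0..})" for x
  proof (rule bdd_belowI2)
    fix t :: real assume "t \<in> {0..}"
    then have "t * q y = q (t *\<^sub>R y)" using sublinear_scale[OF q] by simp
    also have "\<dots> \<le> q (x + t *\<^sub>R y) + q (- x)"
      using sublinear_add[OF q, of "x + t *\<^sub>R y" "- x"] by simp
    finally show "- q (- x) \<le> s t x" by (simp add: s_def)
  qed
  show "sublinear r"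
    unfolding r_def
  proof (rule sublinear_INF)
    fix t u :: real and x z assume "t \<in> {0..}" "u \<in> {0..}"
    moreover have "s (t + u) (x + z) \<le> s t x + s u z"
      using sublinear_add[OF q, of "x + t *\<^sub>R y" "z + u *\<^sub>R y"]
      by (simp add: s_def algebra_simps)
    ultimately show "\<exists>k\<in>{0..}. s k (x + z) \<le> s t x + s u z"
      by (intro bexI[of _ "t + u"]) auto
  next
    fix t c :: real and x assume "t \<in> {0..}" "c > 0"
    moreover have "s (c * t) (c *\<^sub>R x) = c * s t x"
      using sublinear_scale[OF q, of c "x + t *\<^sub>R y"] \<open>c > 0\<close>
      by (simp add: s_def algebra_simps)
    ultimately show "\<exists>k\<in>{0..}. s k (c *\<^sub>R x) \<le> c * s t x"
      by (intro bexI[of _ "c * t"]) auto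
  qed (use bdd in auto)
  have le: "r x \<le> s t x" if "t \<ge> 0" for t x
    unfolding r_def using bdd that by (intro cINF_lower) auto
  show "r x \<le> q x" for x using le[of 0 x] by (simp add: s_def)
  show "r x \<le> q (x + y) - q y" for x using le[of 1 x] by (simp add: s_def)
qed

text \<open>Zorn's lemma below \<open>p\<close>: a nonempty chain has its pointwise infimum as a
  lower bound. The infimum is finite because every sublinear functional below \<open>p\<close> is at
  least \<open>- p (- x)\<close> at \<open>x\<close>.\<close>

lemma minimal_sublinear_exists:
  assumes p: "sublinear p"
  obtains q where "sublinear q" "q \<le> p" "\<And>r. sublinear r \<Longrightarrow> r \<le> q \<Longrightarrow> r = q"
proof -
  define A where "A = {q. sublinear q \<and> q \<le> p}"
  \<comment> \<open>The order is reversed, so that upper bounds and maximal elements in Zorn's lemma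
    become lower bounds and minimal elements.\<close>
  define P :: "('a \<Rightarrow> real) \<Rightarrow> ('a \<Rightarrow> real) \<Rightarrow> bool" where "P = (\<lambda>a b. b \<le> a)"
  have "partial_order_on A (relation_of P A)"
    by (rule partial_order_on_relation_ofI) (auto simp: P_def)
  moreover have "\<exists>u\<in>A. \<forall>a\<in>C. P a u" if C: "C \<in> Chains (relation_of P A)" for C
  proof (cases "C = {}")
    case True
    then show ?thesis using p by (auto simp: A_def)
  next
    case False
    have CA: "C \<subseteq> A" using C by (rule Chains_relation_of)
    have total: "a \<le> b \<or> b \<le> a" if "a \<in> C" "b \<in> C" for a b
      using C that by (auto simp: Chains_def relation_of_def P_def)
    have bdd: "bdd_below ((\<lambda>q. q x) ` C)" for x
    proof (rule bdd_belowI2)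
      fix q assume "q \<in> C"
      then have "sublinear q" "q (- x) \<le> p (- x)" using CA by (auto simp: A_def le_fun_def)
      then show "- p (- x) \<le> q x" using sublinear_minus[of q x] by linarith
    qed
    define u where "u x = (INF q\<in>C. q x)" for x
    have "sublinear u"
      unfolding u_def
    proof (rule sublinear_INF[OF False bdd])
      fix a b :: "'a \<Rightarrow> real" and x y assume ab: "a \<in> C" "b \<in> C"
      then have sub: "sublinear a" "sublinear b" using CA by (auto simp: A_def)
      \<comment> \<open>The smaller of the two functionals serves as \<open>k\<close>.\<close>
      from total[OF ab] show "\<exists>k\<in>C. k (x + y) \<le> a x + b y"
      proof
        assume "a \<le> b"
        then have "a (x + y) \<le> a x + b y"
          using sublinear_add[OF sub(1), of x y] le_funD[of a b y] by linarith
        then show ?thesis using ab by blast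
      next
        assume "b \<le> a"
        then have "b (x + y) \<le> a x + b y"
          using sublinear_add[OF sub(2), of x y] le_funD[of b a x] by linarith
        then show ?thesis using ab by blast
      qed
    next
      fix a :: "'a \<Rightarrow> real" and t :: real and x assume "a \<in> C" "t > 0"
      then show "\<exists>k\<in>C. k (t *\<^sub>R x) \<le> t * a x"
        using CA sublinear_scale[of a t x] by (intro bexI[of _ a]) (auto simp: A_def)
    qed
    moreover have le: "u \<le> a" if "a \<in> C" for a
      unfolding u_def le_fun_def using cINF_lower[OF bdd that] by blast
    moreover have "u \<le> p"
    proof -
      from False obtain a where "a \<in> C" by blast
      then show ?thesis using le CA unfolding A_def by (blast intro: order_trans)
    qed
    ultimately show ?thesis unfolding A_def P_def by blast
  qed
  ultimately have "\<exists>m\<in>A. \<forall>a\<in>A. P m a \<longrightarrow> a = m" by (rule predicate_Zorn)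
  then obtain m where m: "m \<in> A" "\<And>a. a \<in> A \<Longrightarrow> a \<le> m \<Longrightarrow> a = m"
    unfolding P_def by blast
  then show ?thesis
    by (intro that[of m]) (auto simp: A_def intro: order_trans)
qed

text \<open>Instead of extending a functional from the line through \<open>y\<close>, first lower
  \<open>p\<close> to \<open>p'\<close> in direction \<open>y\<close>, then take a minimal sublinear
  \<open>q\<close> below \<open>p'\<close>. Minimality makes \<open>q\<close> linear, and the first
  lowering forces \<open>q y = p y\<close>.\<close>

theorem hahn_banach_sublinear:
  fixes p :: "'a::real_vector \<Rightarrow> real"
  assumes p: "sublinear p"
  obtains f where "linear f" "\<And>x. f x \<le> p x" "f y = p y"
proof -
  obtain p' where p': "sublinear p'" "\<And>x. p' x \<le> p x" "\<And>x. p' x \<le> p (x + y) - p y"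
    using sublinear_lower[OF p] by blast
  obtain q where q: "sublinear q" "q \<le> p'"
    and min: "\<And>r. sublinear r \<Longrightarrow> r \<le> q \<Longrightarrow> r = q"
    using minimal_sublinear_exists[OF p'(1)] by blast
  have add: "q (x + z) = q x + q z" for x z
  proof -
    obtain r where r: "sublinear r" "\<And>x. r x \<le> q x" "\<And>x. r x \<le> q (x + z) - q z"
      using sublinear_lower[OF q(1)] by blast
    \<comment> \<open>Lowering \<open>q\<close> in direction \<open>z\<close> cannot change it, so
      the third property of \<open>r\<close> becomes \<open>q x \<le> q (x + z) - q z\<close>, the
      converse of subadditivity.\<close>
    have "r = q" using r by (intro min) (auto simp: le_fun_def)
    then show ?thesis using r(3)[of x] sublinear_add[OF q(1), of x z] by simp
  qed
  have minus: "q (- x) = - q x" for x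
    using add[of x "- x"] sublinear_zero[OF q(1)] by simp
  have "linear q"
  proof (rule linearI)
    fix t :: real and x
    show "q (t *\<^sub>R x) = t *\<^sub>R q x"
    proof (cases "t \<ge> 0")
      case True
      then show ?thesis using sublinear_scale[OF q(1)] by simp
    next
      case False
      then show ?thesis
        using sublinear_scale[OF q(1), of "- t" x] minus[of "t *\<^sub>R x"] by simp
    qed
  qed (rule add)
  moreover have le: "q x \<le> p x" for x
    using le_funD[OF q(2), of x] p'(2)[of x] by linarith
  \<comment> \<open>At \<open>- y\<close> the bound on \<open>p'\<close> reads
    \<open>p' (- y) \<le> p 0 - p y = - p y\<close>. Hence
    \<open>- q y = q (- y) \<le> - p y\<close>.\<close>
  moreover have "q y = p y"
    using le[of y] le_funD[OF q(2), of "- y"] p'(3)[of "- y"] minus[of y] sublinear_zero[OF p]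
    by simp
  ultimately show ?thesis by (rule that)
qed

section \<open>Distance to a subspace and separation by a continuous functional\<close>

lemma sublinear_infdist:
  fixes M :: "'a::real_normed_vector set"
  assumes M: "subspace M"
  shows "sublinear (\<lambda>x. infdist x M)"
proof -
  have ne: "M \<noteq> {}" using subspace_0[OF M] by blast
  have "sublinear (\<lambda>x. INF a\<in>M. dist x a)"
  proof (rule sublinear_INF[OF ne])
    fix a b x y assume "a \<in> M" "b \<in> M"
    moreover have "dist (x + y) (a + b) \<le> dist x a + dist y b"
      by (rule dist_triangle_add)
    ultimately show "\<exists>k\<in>M. dist (x + y) k \<le> dist x a + dist y b"
      using subspace_add[OF M] by blast
  next
    fix a x and t :: real assume "a \<in> M" "t > 0"
    moreover have "dist (t *\<^sub>R x) (t *\<^sub>R a) = t * dist x a"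
      using \<open>t > 0\<close> by (simp add: dist_norm flip: scaleR_diff_right)
    ultimately show "\<exists>k\<in>M. dist (t *\<^sub>R x) k \<le> t * dist x a"
      using subspace_scale[OF M] by (intro bexI[of _ "t *\<^sub>R a"]) auto
  qed auto
  then show ?thesis using ne by (simp add: infdist_notempty)
qed

text \<open>Apply Hahn-Banach to the distance from \<open>M\<close>: it vanishes on
  \<open>M\<close>, is dominated by the norm, and is positive at \<open>w\<close> because
  \<open>M\<close> is closed.\<close>

theorem closed_subspace_separation:
  fixes M :: "'a::real_normed_vector set"
  assumes M: "subspace M" "closed M" and w: "w \<notin> M"
  obtains f :: "'a \<Rightarrow> real" where "bounded_linear f" "\<And>x. x \<in> M \<Longrightarrow> f x = 0" "f w \<noteq> 0"
proof -
  obtain f where f: "linear f" "\<And>x. f x \<le> infdist x M" "f w = infdist w M"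
    using hahn_banach_sublinear[OF sublinear_infdist[OF M(1)]] by blast
  have zero: "0 \<in> M" using M(1) by (rule subspace_0)
  have minus: "f (- x) = - f x" for x using f(1) by (rule linear_neg)
  have "bounded_linear f"
  proof (rule bounded_linear_intro[where K = 1])
    fix x
    have "f z \<le> norm z" for z
      using f(2)[of z] infdist_le[OF zero, of z] by simp
    from this[of x] this[of "- x"] show "norm (f x) \<le> norm x * 1"
      by (simp add: minus abs_le_iff)
  qed (use f(1) in \<open>auto simp: linear_add linear_scale\<close>)
  moreover have "f x = 0" if x: "x \<in> M" for x
    using f(2)[of x] f(2)[of "- x"] x subspace_neg[OF M(1) x] by (simp add: minus)
  moreover have "f w \<noteq> 0"
    using f(3) in_closed_iff_infdist_zero[OF M(2), of w] zero w by auto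
  ultimately show ?thesis by (rule that)
qed

section \<open>Separation in the product by pairs of dual functionals\<close>

lemma dual_spaceI:
  fixes smul :: "'k::real_normed_field \<Rightarrow> 'a::real_normed_vector \<Rightarrow> 'a"
  assumes smul: "normed_space_over smul"
    and "\<And>x y. f (x + y) = f x + f y" "\<And>c x. f (smul c x) = c * f x" "continuous_on UNIV f"
  shows "f \<in> dual_space smul"
proof -
  interpret normed_space_over smul by fact
  have "vector_space ((*) :: 'k \<Rightarrow> 'k \<Rightarrow> 'k)"
    by unfold_locales (simp_all add: algebra_simps)
  then show ?thesis
    using vector_space_axioms assms
    by (simp add: dual_space_def Vector_Spaces.linear_def module_hom_def module_hom_axioms_def
        module_iff_vector_space)
qed

text \<open>This is the only form in which Hahn-Banach enters the main argument, which can thus be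
  carried out for both scalar fields at once. A functional on the product is given as a pair of
  functionals on the factors, since the weak topology is defined on the space itself.\<close>

definition dual_separates ::
  "('k::real_normed_field \<Rightarrow> 'a::real_normed_vector \<Rightarrow> 'a) \<Rightarrow> bool" where
  "dual_separates smul \<longleftrightarrow>
     (\<forall>M w. subspace M \<and> closed M \<and> (\<forall>c u v. (u, v) \<in> M \<longrightarrow> (smul c u, smul c v) \<in> M) \<and> w \<notin> M \<longrightarrow>
        (\<exists>f\<in>dual_space smul. \<exists>g\<in>dual_space smul.
           (\<forall>(u, v)\<in>M. f u + g v = 0) \<and> f (fst w) + g (snd w) \<noteq> 0))"

lemma bounded_linear_on_prod_split:
  fixes F :: "'a::real_normed_vector \<times> 'b::real_normed_vector \<Rightarrow> real"
  assumes F: "bounded_linear F"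
  obtains f g where "bounded_linear f" "bounded_linear g" "\<And>u v. F (u, v) = f u + g v"
proof
  show "bounded_linear (\<lambda>u. F (u, 0))" "bounded_linear (\<lambda>v. F (0, v))"
    by (intro bounded_linear_compose[OF F] bounded_linear_Pair bounded_linear_ident
        bounded_linear_zero)+
  show "F (u, v) = F (u, 0) + F (0, v)" for u v
    using linear_add[OF bounded_linear.linear[OF F], of "(u, 0)" "(0, v)"] by simp
qed

lemma dual_separates_real: "dual_separates (scaleR :: real \<Rightarrow> 'a::real_normed_vector \<Rightarrow> 'a)"
  unfolding dual_separates_def
proof (intro allI impI)
  fix M :: "('a \<times> 'a) set" and w
  assume a: "subspace M \<and> closed M \<and> (\<forall>c u v. (u, v) \<in> M \<longrightarrow> (c *\<^sub>R u, c *\<^sub>R v) \<in> M) \<and> w \<notin> M"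
  then have M: "subspace M" "closed M" "w \<notin> M" by blast+
  obtain F :: "'a \<times> 'a \<Rightarrow> real"
    where F: "bounded_linear F" "\<And>x. x \<in> M \<Longrightarrow> F x = 0" "F w \<noteq> 0"
    using closed_subspace_separation[OF M] by blast
  obtain f g where fg: "bounded_linear f" "bounded_linear g" "\<And>u v. F (u, v) = f u + g v"
    using bounded_linear_on_prod_split[OF F(1)] by blast
  have dual: "h \<in> dual_space scaleR" if "bounded_linear h" for h :: "'a \<Rightarrow> real"
    using that by (intro dual_spaceI linear_continuous_on)
      (auto simp: normed_space_over_real_iff linear_add linear_scale dest: bounded_linear.linear)
  show "\<exists>f\<in>dual_space scaleR. \<exists>g\<in>dual_space scaleR.
      (\<forall>(u, v)\<in>M. f u + g v = 0) \<and> f (fst w) + g (snd w) \<noteq> 0"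
    using dual[OF fg(1)] dual[OF fg(2)] F(2,3) fg(3) by (cases w) force
qed

text \<open>The complex functional with real part \<open>\<phi>\<close> is \<open>x \<mapsto> \<phi> x - \<i> \<phi> (\<i> x)\<close>.\<close>

lemma complexified_functional_in_dual_space:
  fixes smul :: "complex \<Rightarrow> 'a::real_normed_vector \<Rightarrow> 'a" and \<phi> :: "'a \<Rightarrow> real"
  assumes smul: "normed_space_over smul" and \<phi>: "bounded_linear \<phi>"
  shows "(\<lambda>x. of_real (\<phi> x) - \<i> * of_real (\<phi> (smul \<i> x))) \<in> dual_space smul"
proof -
  interpret normed_space_over smul by fact
  have bl: "bounded_linear (smul \<i>)"
  proof (rule bounded_linear_intro[where K = 1])
    show "smul \<i> (r *\<^sub>R x) = r *\<^sub>R smul \<i> x" for r x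
      by (metis scale_of_real scale_left_commute)
  qed (auto simp: scale_right_distrib norm_scale)
  note lin = bounded_linear.linear[OF \<phi>]
  have decomp: "smul c x = Re c *\<^sub>R x + Im c *\<^sub>R smul \<i> x" for c x
  proof -
    have "smul c x = smul (of_real (Re c) + of_real (Im c) * \<i>) x"
      by (metis complex_eq mult.commute)
    also have "\<dots> = Re c *\<^sub>R x + Im c *\<^sub>R smul \<i> x"
      by (simp add: scale_left_distrib scale_of_real flip: scale_scale)
    finally show ?thesis .
  qed
  have ii: "smul \<i> (smul \<i> x) = - x" for x
    by simp
  show ?thesis
  proof (rule dual_spaceI[OF smul])
    fix c x
    have 1: "\<phi> (smul c x) = Re c * \<phi> x + Im c * \<phi> (smul \<i> x)"
      by (subst decomp) (simp add: linear_add[OF lin] linear_scale[OF lin])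
    have "smul \<i> (smul c x) = smul c (smul \<i> x)"
      by (rule scale_left_commute)
    also have "\<dots> = Re c *\<^sub>R smul \<i> x + Im c *\<^sub>R (- x)"
      using decomp[of c "smul \<i> x"] by (simp only: ii)
    finally have 2: "\<phi> (smul \<i> (smul c x)) = Re c * \<phi> (smul \<i> x) - Im c * \<phi> x"
      by (simp add: linear_diff[OF lin] linear_scale[OF lin])
    show "of_real (\<phi> (smul c x)) - \<i> * of_real (\<phi> (smul \<i> (smul c x)))
        = c * (of_real (\<phi> x) - \<i> * of_real (\<phi> (smul \<i> x)))"
      unfolding 1 2 by (simp add: complex_eq_iff algebra_simps)
  next
    show "continuous_on UNIV (\<lambda>x. complex_of_real (\<phi> x) - \<i> * of_real (\<phi> (smul \<i> x)))"
      by (intro continuous_intros linear_continuous_on \<phi> bounded_linear_compose[OF \<phi> bl])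
  qed (simp add: linear_add[OF lin] scale_right_distrib algebra_simps)
qed

text \<open>Separate by a real functional \<open>F\<close> and complexify both of its components.
  The sum then has real part \<open>F (u, v)\<close> and imaginary part
  \<open>- F (smul \<i> u, smul \<i> v)\<close>. Both vanish on \<open>M\<close> because
  \<open>M\<close> is stable under \<open>smul \<i>\<close>, while the real part is nonzero at
  \<open>w\<close>.\<close>

lemma dual_separates_complex:
  fixes smul :: "complex \<Rightarrow> 'a::real_normed_vector \<Rightarrow> 'a"
  assumes smul: "normed_space_over smul"
  shows "dual_separates smul"
  unfolding dual_separates_def
proof (intro allI impI)
  fix M :: "('a \<times> 'a) set" and w
  assume a: "subspace M \<and> closed M \<and> (\<forall>c u v. (u, v) \<in> M \<longrightarrow> (smul c u, smul c v) \<in> M) \<and> w \<notin> M"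
  then have M: "subspace M" "closed M" "w \<notin> M" by blast+
  obtain F :: "'a \<times> 'a \<Rightarrow> real"
    where F: "bounded_linear F" "\<And>x. x \<in> M \<Longrightarrow> F x = 0" "F w \<noteq> 0"
    using closed_subspace_separation[OF M] by blast
  obtain f g where fg: "bounded_linear f" "bounded_linear g" "\<And>u v. F (u, v) = f u + g v"
    using bounded_linear_on_prod_split[OF F(1)] by blast
  define C where "C h x = complex_of_real (h x) - \<i> * of_real (h (smul \<i> x))" for h x
  have C: "C f \<in> dual_space smul" "C g \<in> dual_space smul"
    unfolding C_def using complexified_functional_in_dual_space[OF smul] fg by blast+
  have eq: "C f u + C g v = of_real (F (u, v)) - \<i> * of_real (F (smul \<i> u, smul \<i> v))" for u v
    by (simp add: C_def fg(3) algebra_simps)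
  have "C f u + C g v = 0" if "(u, v) \<in> M" for u v
    unfolding eq using F(2) that a by simp
  moreover have "C f (fst w) + C g (snd w) \<noteq> 0"
    unfolding eq using F(3) by (simp add: complex_eq_iff)
  ultimately show "\<exists>f\<in>dual_space smul. \<exists>g\<in>dual_space smul.
      (\<forall>(u, v)\<in>M. f u + g v = 0) \<and> f (fst w) + g (snd w) \<noteq> 0"
    using C by blast
qed

section \<open>Weakly compact sets of eigenvectors\<close>

text \<open>Separability need not pass to subspaces of a general topological space, but second
  countability does; it is needed for \<open>D - {0}\<close>. The base consists of the traces on
  \<open>D\<close> of balls with radius \<open>1/(n+1)\<close> around a countable dense set.\<close>

lemma second_countable_separable_metric:
  fixes D :: "'a::metric_space set"
  assumes "separable_space (top_of_set D)"
  shows "second_countable (top_of_set D)"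
proof -
  obtain C where C: "countable C" "C \<subseteq> D" "top_of_set D closure_of C = D"
    using assms by (auto simp: separable_space_def)
  have dense: "D \<subseteq> closure C"
    using C(2,3) by (auto simp: closure_of_subtopology Int_absorb1)
  define \<B> where "\<B> = (\<lambda>(c, n). D \<inter> ball c (inverse (real (Suc n)))) ` (C \<times> UNIV)"
  show ?thesis
    unfolding second_countable_def
  proof (intro exI conjI allI impI ballI)
    show "countable \<B>" unfolding \<B>_def using C(1) by auto
    show "openin (top_of_set D) V" if "V \<in> \<B>" for V
      using that by (auto simp: \<B>_def)
    fix U x assume Ux: "openin (top_of_set D) U \<and> x \<in> U"
    then obtain e where e: "e > 0" "ball x e \<inter> D \<subseteq> U" "x \<in> D"
      unfolding openin_contains_ball by blast
    \<comment> \<open>Half of \<open>e\<close> is enough: the centre \<open>c\<close> is within this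
      radius of \<open>x\<close>, so the ball around \<open>c\<close> stays in
      \<open>ball x e\<close>.\<close>
    obtain n where n: "inverse (real (Suc n)) < e / 2"
      using reals_Archimedean[of "e / 2"] e(1) by auto
    obtain c where c: "c \<in> C" "dist c x < inverse (real (Suc n))"
      using dense e(3) unfolding closure_approachable
      by (metis closure_approachable inverse_positive_iff_positive of_nat_0_less_iff subsetD zero_less_Suc)
    have "ball c (inverse (real (Suc n))) \<subseteq> ball x e"
    proof
      fix z assume "z \<in> ball c (inverse (real (Suc n)))"
      then show "z \<in> ball x e"
        using c(2) n dist_triangle[of x z c] by (simp add: dist_commute)
    qed
    then have "D \<inter> ball c (inverse (real (Suc n))) \<subseteq> U" using e(2) by blast
    moreover have "x \<in> D \<inter> ball c (inverse (real (Suc n)))" using c(2) e(3) by simp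
    moreover have "D \<inter> ball c (inverse (real (Suc n))) \<in> \<B>"
      unfolding \<B>_def using c(1) by (intro image_eqI[of _ _ "(c, n)"]) auto
    ultimately show "\<exists>V\<in>\<B>. x \<in> V \<and> V \<subseteq> U" by blast
  qed
qed

lemma continuous_map_weak_topology:
  assumes smul: "normed_space_over smul" and f: "f \<in> dual_space smul"
  shows "continuous_map (weak_topology smul) euclidean f"
proof -
  have "openin (weak_topology smul) (f -` U)" if "open U" for U
    unfolding weak_topology_def using f that by (intro topology_generated_by_Basis) blast
  then show ?thesis
    by (simp add: continuous_map topspace_weak_topology[OF smul] vimage_def)
qed

lemma dual_separates_points:
  fixes smul :: "'k::real_normed_field \<Rightarrow> 'a::real_normed_vector \<Rightarrow> 'a"
  assumes smul: "normed_space_over smul" and sep: "dual_separates smul" and x: "x \<noteq> 0"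
  obtains f where "f \<in> dual_space smul" "f x \<noteq> 0"
proof -
  interpret V: normed_space_over smul by fact
  \<comment> \<open>Separating \<open>(x, x)\<close> from the zero subspace gives
    \<open>f x + g x \<noteq> 0\<close>, so \<open>f\<close> or \<open>g\<close> is nonzero at
    \<open>x\<close>.\<close>
  have "subspace {0 :: 'a \<times> 'a} \<and> closed {0 :: 'a \<times> 'a} \<and>
      (\<forall>c u v. (u, v) \<in> {0 :: 'a \<times> 'a} \<longrightarrow> (smul c u, smul c v) \<in> {0 :: 'a \<times> 'a}) \<and> (x, x) \<notin> {0}"
    using x by (auto simp: subspace_def zero_prod_def)
  then obtain f g where "f \<in> dual_space smul" "g \<in> dual_space smul" "f x + g x \<noteq> 0"
    using sep[unfolded dual_separates_def, rule_format, of "{0}" "(x, x)"] by auto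
  then show ?thesis using that by (metis add.right_neutral)
qed

text \<open>Two topologies cooperate: countably many functionals are selected in the norm topology,
  where \<open>D - {0}\<close> is Lindelof, while the pieces cut out by them are weakly closed in
  the given weakly compact sets.\<close>

lemma nonzero_vectors_weakly_sigma_compact:
  fixes smul :: "'k::real_normed_field \<Rightarrow> 'a::real_normed_vector \<Rightarrow> 'a"
  assumes smul: "normed_space_over smul" and sep: "dual_separates smul"
    and D: "separable_space (top_of_set D)" "weakly_sigma_compact smul D"
  shows "weakly_sigma_compact smul (D - {0})"
proof -
  obtain \<K> where \<K>: "countable \<K>" "\<And>K. K \<in> \<K> \<Longrightarrow> compactin (weak_topology smul) K" "D = \<Union>\<K>"
    using D(2) unfolding weakly_sigma_compact_def by blast
  define N where "N f = {x \<in> D - {0}. f x \<noteq> 0}" for f :: "'a \<Rightarrow> 'k"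
  have Lin: "Lindelof_space (top_of_set (D - {0}))"
    using second_countable_subtopology[OF second_countable_separable_metric[OF D(1)], of "D - {0}"]
    by (intro second_countable_imp_Lindelof_space) (simp add: subtopology_subtopology Int_absorb1)
  have op: "openin (top_of_set (D - {0})) (N f)" if "f \<in> dual_space smul" for f
  proof -
    have "open (f -` (- {0}))"
      using that by (intro open_vimage) (auto simp: dual_space_def)
    moreover have "N f = (D - {0}) \<inter> f -` (- {0})" by (auto simp: N_def)
    ultimately show ?thesis by (simp add: openin_open_Int)
  qed
  have cover: "\<Union>(N ` dual_space smul) = D - {0}"
  proof (intro equalityI subsetI)
    fix x assume x: "x \<in> D - {0}"
    then obtain f where "f \<in> dual_space smul" "f x \<noteq> 0"
      using dual_separates_points[OF smul sep] by blast
    then show "x \<in> \<Union>(N ` dual_space smul)" using x by (auto simp: N_def)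
  qed (auto simp: N_def)
  obtain \<V> where \<V>: "countable \<V>" "\<V> \<subseteq> N ` dual_space smul" "\<Union>\<V> = D - {0}"
    using Lin op cover unfolding Lindelof_space_def
    by (metis (no_types, lifting) imageE topspace_euclidean_subtopology)
  obtain \<Phi> where \<Phi>: "countable \<Phi>" "\<Phi> \<subseteq> dual_space smul" "\<V> = N ` \<Phi>"
    using \<V>(1,2) by (metis countable_subset_image)
  \<comment> \<open>The lower bound on \<open>norm (f x)\<close> is a weakly closed condition that
    excludes 0, unlike \<open>f x \<noteq> 0\<close>, and every \<open>x\<close> with
    \<open>f x \<noteq> 0\<close> satisfies it for large \<open>n\<close>.\<close>
  define L where "L = (\<lambda>(K :: 'a set, f, n). K \<inter> {x. norm (f x :: 'k) \<ge> inverse (real (Suc n))})"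
  have "countable (L ` (\<K> \<times> \<Phi> \<times> UNIV))"
    using \<K>(1) \<Phi>(1) by auto
  moreover have "compactin (weak_topology smul) (L (K, f, n))" if "K \<in> \<K>" "f \<in> \<Phi>" for K f n
  proof -
    have "continuous_map (weak_topology smul) euclidean f"
      using continuous_map_weak_topology[OF smul] \<Phi>(2) that by blast
    moreover have "closed {z :: 'k. norm z \<ge> inverse (real (Suc n))}"
      by (intro closed_Collect_le continuous_intros)
    ultimately have "closedin (weak_topology smul)
        {x \<in> topspace (weak_topology smul). f x \<in> {z. norm z \<ge> inverse (real (Suc n))}}"
      by (intro closedin_continuous_map_preimage) auto
    then have "closedin (weak_topology smul) {x. norm (f x) \<ge> inverse (real (Suc n))}"
      by (simp add: topspace_weak_topology[OF smul])
    then show ?thesis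
      unfolding L_def prod.case using \<K>(2)[OF that(1)] by (intro compact_Int_closedin)
  qed
  moreover have "D - {0} = \<Union>(L ` (\<K> \<times> \<Phi> \<times> UNIV))"
  proof (intro equalityI subsetI)
    fix x assume x: "x \<in> D - {0}"
    then obtain f where f: "f \<in> \<Phi>" "f x \<noteq> 0"
      using \<V>(3) \<Phi>(3) by (auto simp: N_def)
    from x obtain K where K: "K \<in> \<K>" "x \<in> K" using \<K>(3) by blast
    obtain n where "inverse (real (Suc n)) < norm (f x)"
      using reals_Archimedean[of "norm (f x)"] f(2) by auto
    then have "x \<in> L (K, f, n)" using K by (simp add: L_def)
    then show "x \<in> \<Union>(L ` (\<K> \<times> \<Phi> \<times> UNIV))" using K f by blast
  next
    fix x assume "x \<in> \<Union>(L ` (\<K> \<times> \<Phi> \<times> UNIV))"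
    then obtain K f n where *: "K \<in> \<K>" "f \<in> \<Phi>" "x \<in> K" "inverse (real (Suc n)) \<le> norm (f x)"
      by (auto simp: L_def)
    interpret normed_space_over smul by fact
    have "f 0 = 0"
    proof -
      have "Vector_Spaces.linear smul (*) f" using * \<Phi>(2) by (auto simp: dual_space_def)
      then have "f (0 + 0) = f 0 + f 0"
        by (simp only: Vector_Spaces.linear_def module_hom_def module_hom_axioms_def)
      then show ?thesis by simp
    qed
    moreover have "f x \<noteq> 0" using *(4) by (metis inverse_positive_iff_positive norm_zero not_le of_nat_0_less_iff zero_less_Suc)
    ultimately show "x \<in> D - {0}" using * \<K>(3) by auto
  qed
  ultimately show ?thesis
    unfolding weakly_sigma_compact_def by (intro exI[of _ "L ` (\<K> \<times> \<Phi> \<times> UNIV)"]) auto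
qed

text \<open>The pairs \<open>(x, l)\<close> with \<open>(x, smul l x) \<in> G\<close> form a closed
  subset of the product of \<open>K\<close>, weakly topologized, with the scalars. Projection along
  the compact factor \<open>K\<close> is a closed map.\<close>

lemma closed_eigenvalues_of_weakly_compact:
  fixes smul :: "'k::real_normed_field \<Rightarrow> 'a::real_normed_vector \<Rightarrow> 'a"
  assumes smul: "normed_space_over smul" and sep: "dual_separates smul"
    and G: "subspace G" "closed G" "\<And>c u v. (u, v) \<in> G \<Longrightarrow> (smul c u, smul c v) \<in> G"
    and K: "compactin (weak_topology smul) K"
  shows "closed {l. \<exists>x\<in>K. (x, smul l x) \<in> G}"
proof -
  interpret normed_space_over smul by fact
  define X where "X = subtopology (weak_topology smul) K"
  have topX: "topspace X = K"
    by (simp add: X_def topspace_weak_topology[OF smul])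
  have scale: "g (smul l x) = l * g x" if "g \<in> dual_space smul" for g l x
  proof -
    have "Vector_Spaces.linear smul (*) g" using that by (simp add: dual_space_def)
    then show ?thesis
      by (simp only: Vector_Spaces.linear_def module_hom_def module_hom_axioms_def)
  qed
  define \<F> where "\<F> = {(f, g). f \<in> dual_space smul \<and> g \<in> dual_space smul \<and> (\<forall>(u, v)\<in>G. f u + g v = 0)}"
  \<comment> \<open>Here \<open>g (smul l x)\<close> is written as \<open>l * g x\<close>, which is
    jointly continuous in \<open>x\<close> (weakly) and \<open>l\<close>.\<close>
  define Z where "Z = (\<lambda>(f, g). {(x, l). x \<in> K \<and> f x + l * g x = (0 :: 'k)})"
  have cl: "closedin (prod_topology X euclidean) (Z (f, g))"
    if "f \<in> dual_space smul" "g \<in> dual_space smul" for f g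
  proof -
    let ?P = "prod_topology X (euclidean :: 'k topology)"
    have cont: "continuous_map ?P euclidean (\<lambda>z. h (fst z))" if "h \<in> dual_space smul" for h
    proof -
      have "continuous_map X euclidean h"
        unfolding X_def using continuous_map_weak_topology[OF smul that]
        by (rule continuous_map_from_subtopology)
      from continuous_map_compose[OF continuous_map_fst this] show ?thesis by (simp add: o_def)
    qed
    have "continuous_map ?P (prod_topology euclidean (prod_topology euclidean euclidean))
        (\<lambda>z. (f (fst z), (snd z, g (fst z))))"
      by (intro continuous_map_pairedI cont that continuous_map_snd)
    then have 1: "continuous_map ?P euclidean (\<lambda>z. (f (fst z), (snd z, g (fst z))))"
      by simp
    have "continuous_map euclidean euclidean (\<lambda>(a :: 'k, (b, c)). a + b * c)"
      by (auto simp: case_prod_unfold intro!: continuous_intros)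
    from continuous_map_compose[OF 1 this]
    have "continuous_map ?P euclidean (\<lambda>z. f (fst z) + snd z * g (fst z))"
      by (simp add: o_def)
    then have "closedin ?P {z \<in> topspace ?P. f (fst z) + snd z * g (fst z) \<in> {0}}"
      by (rule closedin_continuous_map_preimage) simp
    moreover have "{z \<in> topspace ?P. f (fst z) + snd z * g (fst z) \<in> {0}} = Z (f, g)"
      by (auto simp: Z_def topX)
    ultimately show ?thesis by simp
  qed
  define C where "C = {(x, l). x \<in> K \<and> (x, smul l x) \<in> G}"
  have CZ: "C = topspace (prod_topology X euclidean) \<inter> \<Inter>(Z ` \<F>)"
  proof (intro equalityI subsetI)
    fix z assume "z \<in> C"
    then show "z \<in> topspace (prod_topology X euclidean) \<inter> \<Inter>(Z ` \<F>)"
      by (fastforce simp: C_def Z_def \<F>_def topX scale)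
  next
    fix z assume z: "z \<in> topspace (prod_topology X euclidean) \<inter> \<Inter>(Z ` \<F>)"
    obtain x l where xl: "z = (x, l)" by (cases z)
    have "x \<in> K" using z by (simp add: xl topX)
    moreover have "(x, smul l x) \<in> G"
    \<comment> \<open>If the pair were outside \<open>G\<close>, a separating pair
      \<open>(f, g)\<close> would belong to \<open>\<F>\<close>, and membership of \<open>z\<close>
      in \<open>Z (f, g)\<close> would contradict the separation.\<close>
    proof (rule ccontr)
      assume "(x, smul l x) \<notin> G"
      then obtain f g where fg: "f \<in> dual_space smul" "g \<in> dual_space smul"
        "\<forall>(u, v)\<in>G. f u + g v = 0" "f x + g (smul l x) \<noteq> 0"
        using sep[unfolded dual_separates_def, rule_format, of G "(x, smul l x)"] G by auto
      then have "(x, l) \<in> Z (f, g)" using z by (auto simp: xl \<F>_def)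
      then show False using fg by (simp add: Z_def scale)
    qed
    ultimately show "z \<in> C" by (simp add: C_def xl)
  qed
  have "closedin (prod_topology X euclidean) C"
  proof -
    \<comment> \<open>Inserting the whole space makes the family visibly nonempty, as
      \<open>closedin_Inter\<close> requires.\<close>
    have "\<Inter>(insert (topspace (prod_topology X (euclidean :: 'k topology))) (Z ` \<F>)) = C"
      using CZ by simp
    moreover have "closedin (prod_topology X euclidean)
        (\<Inter>(insert (topspace (prod_topology X (euclidean :: 'k topology))) (Z ` \<F>)))"
      using cl by (intro closedin_Inter) (auto simp: \<F>_def simp del: topspace_prod_topology)
    ultimately show ?thesis by simp
  qed
  moreover have "closed_map (prod_topology X (euclidean :: 'k topology)) euclidean snd"
    using K by (intro Abstract_Topological_Spaces.closed_map_snd)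
      (simp add: X_def compact_space_subtopology)
  ultimately have "closed (snd ` C)"
    by (simp add: closed_map_def)
  moreover have "snd ` C = {l. \<exists>x\<in>K. (x, smul l x) \<in> G}"
    by (force simp: C_def)
  ultimately show ?thesis by simp
qed

section \<open>Graphs of operators and the point spectrum\<close>

text \<open>The first two claims will be used for the operator whose graph is the closure, the last
  two for the original operator.\<close>

lemma op_graph_subspace:
  assumes smul: "normed_space_over smul" and T: "operator_in smul D T"
  shows "subspace (op_graph D T)"
    and "(u, v) \<in> op_graph D T \<Longrightarrow> (smul c u, smul c v) \<in> op_graph D T"
    and "T 0 = 0" and "0 \<in> D"
proof -
  interpret normed_space_over smul by fact
  note T' = T[unfolded operator_in_def]
  have sub: "subspace D" using T' by blast
  show 0: "0 \<in> D" using sub by (rule subspace_0)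
  have "T (smul 0 0) = smul 0 (T 0)" using T' 0 by blast
  then show T0: "T 0 = 0" by simp
  show scale: "(smul c u, smul c v) \<in> op_graph D T" if "(u, v) \<in> op_graph D T" for c u v
    using that T' subspace_scale[OF sub] by (auto simp: op_graph_def)
  \<comment> \<open>The unqualified \<open>subspace\<close> now refers to \<open>smul\<close>. Real
    scalars are handled through \<open>of_real r\<close>.\<close>
  show "Real_Vector_Spaces.subspace (op_graph D T)"
  proof (rule real_vector.subspaceI)
    show "0 \<in> op_graph D T" using 0 T0 by (auto simp: op_graph_def zero_prod_def)
    show "x + y \<in> op_graph D T" if "x \<in> op_graph D T" "y \<in> op_graph D T" for x y
      using that T' subspace_add[OF sub] by (auto simp: op_graph_def)
    show "r *\<^sub>R x \<in> op_graph D T" if "x \<in> op_graph D T" for r x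
      using that scale[of "fst x" "snd x" "of_real r"] by (cases x) (simp add: scale_of_real)
  qed
qed

theorem fsigma_point_spectrum:
  fixes smul :: "'k::real_normed_field \<Rightarrow> 'a::real_normed_vector \<Rightarrow> 'a"
  assumes smul: "normed_space_over smul" and sep: "dual_separates smul"
    and T: "closable_operator smul D T"
    and D: "separable_space (top_of_set D)" "weakly_sigma_compact smul D"
  shows "fsigma_in euclidean (point_spectrum smul D T)"
proof -
  interpret normed_space_over smul by fact
  obtain E S where TD: "operator_in smul D T" and SE: "operator_in smul E S"
    and cl: "closure (op_graph D T) = op_graph E S"
    using T unfolding closable_operator_def by blast
  define G where "G = op_graph E S"
  have clG: "closed G" unfolding G_def cl[symmetric] by simp
  \<comment> \<open>Closability enters here: \<open>G\<close> is single-valued and contains the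
    graph of \<open>T\<close>, so above a point of \<open>D\<close> the closure adds no new
    value.\<close>
  have graph: "(x, y) \<in> G \<longleftrightarrow> y = T x" if x: "x \<in> D" for x y
  proof -
    have "(x, T x) \<in> G"
      unfolding G_def cl[symmetric] using x closure_subset by (fastforce simp: op_graph_def)
    then show ?thesis by (auto simp: G_def op_graph_def)
  qed
  obtain \<K> where \<K>: "countable \<K>" "\<And>K. K \<in> \<K> \<Longrightarrow> compactin (weak_topology smul) K" "D - {0} = \<Union>\<K>"
    using nonzero_vectors_weakly_sigma_compact[OF smul sep D]
    unfolding weakly_sigma_compact_def by blast
  \<comment> \<open>Since \<open>0 \<in> D\<close> and \<open>T 0 = 0\<close>, the kernel always
    contains 0. It differs from \<open>{0}\<close> exactly when there is a nonzero
    eigenvector.\<close>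
  have "point_spectrum smul D T = {l. \<exists>x\<in>D - {0}. T x = smul l x}"
    using op_graph_subspace(3,4)[OF smul TD]
    by (auto simp: point_spectrum_def op_kernel_def)
  also have "\<dots> = {l. \<exists>x\<in>D - {0}. (x, smul l x) \<in> G}"
    by (metis (no_types, lifting) DiffD1 graph)
  also have "\<dots> = (\<Union>K\<in>\<K>. {l. \<exists>x\<in>K. (x, smul l x) \<in> G})"
    unfolding \<K>(3) by blast
  finally have eq: "point_spectrum smul D T = (\<Union>K\<in>\<K>. {l. \<exists>x\<in>K. (x, smul l x) \<in> G})" .
  have "closed {l. \<exists>x\<in>K. (x, smul l x) \<in> G}" if "K \<in> \<K>" for K
    using op_graph_subspace(1,2)[OF smul SE] clG \<K>(2)[OF that]
    by (intro closed_eigenvalues_of_weakly_compact[OF smul sep]) (auto simp: G_def)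
  then show ?thesis
    unfolding eq using \<K>(1) by (intro fsigma_in_Union) (auto intro: closed_imp_fsigma_in)
qed

theorem theorem3p5:
  shows
    "(\<forall>(D :: 'x::banach set) (T :: 'x \<Rightarrow> 'x).
        closable_operator scaleR D T \<and>
        separable_space (top_of_set D) \<and>
        weakly_sigma_compact scaleR D \<longrightarrow>
        fsigma_in euclidean (point_spectrum scaleR D T)) \<and>
     (\<forall>(smul :: complex \<Rightarrow> 'z::banach \<Rightarrow> 'z) (D :: 'z set) (T :: 'z \<Rightarrow> 'z).
        normed_space_over smul \<and>
        closable_operator smul D T \<and>
        separable_space (top_of_set D) \<and>
        weakly_sigma_compact smul D \<longrightarrow>
        fsigma_in euclidean (point_spectrum smul D T))"
proof (intro conjI allI impI; elim conjE)
  fix D :: "'x set" and T :: "'x \<Rightarrow> 'x"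
  assume "closable_operator scaleR D T" "separable_space (top_of_set D)" "weakly_sigma_compact scaleR D"
  then show "fsigma_in euclidean (point_spectrum scaleR D T)"
    by (intro fsigma_point_spectrum dual_separates_real) (simp_all add: normed_space_over_real_iff)
next
  fix smul :: "complex \<Rightarrow> 'z \<Rightarrow> 'z" and D :: "'z set" and T :: "'z \<Rightarrow> 'z"
  assume "normed_space_over smul" "closable_operator smul D T"
    "separable_space (top_of_set D)" "weakly_sigma_compact smul D"
  then show "fsigma_in euclidean (point_spectrum smul D T)"
    by (intro fsigma_point_spectrum dual_separates_complex)
qed

end
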